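(* Let $G$ be a connected graph with $n$ vertices $v_1,\dots,v_n$, $m$ edges, and degrees $d_{i}=\deg(v_{i})$, and let $0\le\alpha\le1$. If $\mathrm{diam}(G)\leq 2$ and none of $F_{1},F_{2},F_{3}$ is an induced subgraph of $G$, then $$\rho(L(G))\geq\frac{2m^{2}-\sum_{i=1}^{n}d_{i}^{2}}{m}.$$
   Context: $L(G)$ is the line graph of $G$ (vertices are the edges of $G$, adjacent iff they share an endpoint). For a connected graph $H$, the generalized distance matrix is $\mathcal{D}_\alpha(H)=\alpha\,Tr(H)+(1-\alpha)\mathcal{D}(H)$, where $\mathcal{D}(H)$ is the distance matrix and $Tr(H)$ the diagonal matrix of vertex transmissions $Tr(u)=\sum_v d(u,v)$; $\rho(H)$ is its largest eigenvalue. $F_1$ is the path on $5$ vertices; $F_2$ is the graph obtained by identifying a vertex of a triangle with an end vertex of the path on $3$ vertices; $F_3$ is the graph obtained by identifying a vertex of a triangle with a vertex of another triangle. *)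

theory Defs
  imports
    "Graph_Theory.Graph_Theory"
    "Jordan_Normal_Form.Spectral_Radius"
begin

text \<open>
  Finite simple undirected graphs are the locale \<open>pair_graph\<close>: finite, loop-free, with a symmetric
  set of arcs. Every undirected edge is represented by its two arcs, so the edges proper are the
  two-element sets below, and the degree of a vertex is its \<open>out_degree\<close>.
\<close>

definition edges :: "'a pair_pre_digraph \<Rightarrow> 'a set set" where
  "edges G = {{u, v} | u v. (u, v) \<in> parcs G}"

definition line_graph :: "'a pair_pre_digraph \<Rightarrow> 'a set pair_pre_digraph" where
  "line_graph G =
    \<lparr>pverts = edges G,
     parcs = {(e, f). e \<in> edges G \<and> f \<in> edges G \<and> e \<noteq> f \<and> e \<inter> f \<noteq> {}}\<rparr>"

text \<open>The hop distance; it is \<open>\<infinity>\<close> between different components.\<close>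

definition graph_dist :: "'a pair_pre_digraph \<Rightarrow> 'a \<Rightarrow> 'a \<Rightarrow> ereal" where
  "graph_dist G u v = wf_digraph.\<mu> (with_proj G) (\<lambda>_. 1) u v"

definition diam :: "'a pair_pre_digraph \<Rightarrow> ereal" where
  "diam G = (SUP u\<in>pverts G. SUP v\<in>pverts G. graph_dist G u v)"

definition has_induced_copy :: "'a pair_pre_digraph \<Rightarrow> 'b pair_pre_digraph \<Rightarrow> bool" where
  "has_induced_copy G F \<longleftrightarrow>
    (\<exists>H :: 'a pair_pre_digraph.
      induced_subgraph (with_proj H) (with_proj G) \<and> digraph_iso (with_proj F) (with_proj H))"

text \<open>
  In \<open>F2\<close> and \<open>F3\<close> the identified vertex is \<open>2\<close>: the triangle \<open>0, 1, 2\<close> is glued to the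
  path \<open>2, 3, 4\<close> and to the triangle \<open>2, 3, 4\<close>, respectively.
\<close>

definition F1 :: "nat pair_pre_digraph" where
  "F1 = \<lparr>pverts = {0, 1, 2, 3, 4}, parcs = symcl {(0, 1), (1, 2), (2, 3), (3, 4)}\<rparr>"

definition F2 :: "nat pair_pre_digraph" where
  "F2 = \<lparr>pverts = {0, 1, 2, 3, 4}, parcs = symcl {(0, 1), (0, 2), (1, 2), (2, 3), (3, 4)}\<rparr>"

definition F3 :: "nat pair_pre_digraph" where
  "F3 = \<lparr>pverts = {0, 1, 2, 3, 4}, parcs = symcl {(0, 1), (0, 2), (1, 2), (2, 3), (2, 4), (3, 4)}\<rparr>"

definition transmission :: "'a pair_pre_digraph \<Rightarrow> 'a \<Rightarrow> real" where
  "transmission G u = (\<Sum>v\<in>pverts G. real_of_ereal (graph_dist G u v))"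

text \<open>
  The matrices depend on an ordering of the vertices, given as a list \<open>vs\<close> without repetitions
  of all vertices. They are meaningful for connected graphs only, where all distances are finite.
\<close>

definition distance_mat :: "'a pair_pre_digraph \<Rightarrow> 'a list \<Rightarrow> real mat" where
  "distance_mat G vs =
    mat (length vs) (length vs) (\<lambda>(i, j). real_of_ereal (graph_dist G (vs ! i) (vs ! j)))"

definition transmission_mat :: "'a pair_pre_digraph \<Rightarrow> 'a list \<Rightarrow> real mat" where
  "transmission_mat G vs =
    mat (length vs) (length vs) (\<lambda>(i, j). if i = j then transmission G (vs ! i) else 0)"

definition gen_distance_mat :: "real \<Rightarrow> 'a pair_pre_digraph \<Rightarrow> 'a list \<Rightarrow> real mat" where
  "gen_distance_mat \<alpha> G vs =
    \<alpha> \<cdot>\<^sub>m transmission_mat G vs + (1 - \<alpha>) \<cdot>\<^sub>m distance_mat G vs"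

text \<open>
  The matrix is real symmetric, so all its eigenvalues are real; for nonempty \<open>vs\<close> the spectrum
  is finite and nonempty, hence the maximum exists.
\<close>

definition gen_distance_rho :: "real \<Rightarrow> 'a pair_pre_digraph \<Rightarrow> 'a list \<Rightarrow> real" where
  "gen_distance_rho \<alpha> G vs = Max (spectrum (gen_distance_mat \<alpha> G vs))"

end

theory Submission
  imports Defs "HOL-Analysis.Function_Topology"
begin

text \<open>
  For edges \<open>e\<close> and \<open>f\<close> the distance in the line graph is at least \<open>2 - card (e \<inter> f)\<close>:
  this is \<open>0\<close> for \<open>e = f\<close>, \<open>1\<close> for adjacent and \<open>2\<close> for disjoint edges. Counting the triples of a vertex
  and two edges through it in two ways, the sum of \<open>card (e \<inter> f)\<close> over all pairs of edges is the sum
  of the squared degrees. Hence the entries of the generalized distance matrix, whose row sums are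
  the transmissions whatever \<open>\<alpha>\<close> is, add up to at least the numerator of the bound. The
  Rayleigh quotient of the all-ones vector then bounds the largest eigenvalue.
\<close>

section \<open>The Rayleigh bound\<close>

text \<open>Vectors are functions on \<open>nat\<close> that vanish from \<open>n\<close> on, so the
  sphere is a closed subset of a product of compact sets, and Tychonoff applies. Compactness serves
  to let a quadratic form attain its maximum.\<close>

lemma compact_unit_sphere_fun:
  "compact {x :: nat \<Rightarrow> real. (\<forall>i\<ge>n. x i = 0) \<and> (\<Sum>i<n. (x i)\<^sup>2) = 1}" (is "compact ?S")
proof -
  \<comment> \<open>The factor \<open>{0}\<close> pins the coordinates from \<open>n\<close> on;
    with the full line there the product would not be compact.\<close>
  let ?B = "\<lambda>i. if i < n then {-1..1} else {0 :: real}"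
  have "compactin (product_topology (\<lambda>_. euclidean) UNIV) (Pi\<^sub>E UNIV ?B)"
    by (subst compactin_PiE) auto
  then have compact: "compact (Pi\<^sub>E UNIV ?B)"
    by (simp add: euclidean_product_topology)
  have "closed {x :: nat \<Rightarrow> real. (\<Sum>i<n. (x i)\<^sup>2) = 1}"
    by (intro closed_Collect_eq continuous_intros continuous_on_product_coordinates)
  then have "compact (Pi\<^sub>E UNIV ?B \<inter> {x. (\<Sum>i<n. (x i)\<^sup>2) = 1})"
    by (rule compact_Int_closed[OF compact])
  moreover have "Pi\<^sub>E UNIV ?B \<inter> {x. (\<Sum>i<n. (x i)\<^sup>2) = 1} = ?S"
  proof (intro equalityI subsetI)
    fix x :: "nat \<Rightarrow> real"
    assume x: "x \<in> Pi\<^sub>E UNIV ?B \<inter> {x. (\<Sum>i<n. (x i)\<^sup>2) = 1}"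
    then have "x i = 0" if "i \<ge> n" for i
      using that by (auto simp: PiE_iff dest: spec[of _ i])
    then show "x \<in> ?S" using x by simp
  next
    fix x :: "nat \<Rightarrow> real"
    assume x: "x \<in> ?S"
    have "\<bar>x i\<bar> \<le> 1" if "i < n" for i
    proof -
      have "(x i)\<^sup>2 \<le> (\<Sum>i<n. (x i)\<^sup>2)"
        using that by (intro member_le_sum) auto
      then show ?thesis using x by (simp add: abs_square_le_1)
    qed
    then show "x \<in> Pi\<^sub>E UNIV ?B \<inter> {x. (\<Sum>i<n. (x i)\<^sup>2) = 1}"
      using x by (auto simp: abs_le_iff PiE_iff)
  qed
  ultimately show ?thesis by simp
qed

text \<open>Variational principle: a maximiser \<open>x\<close> of the form on the unit sphere is an
  eigenvector, with the maximum \<open>l\<close> as eigenvalue. Symmetry enters when the two mixed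
  terms of the perturbed form are merged.\<close>

lemma symmetric_form_eigenvector:
  fixes a :: "nat \<Rightarrow> nat \<Rightarrow> real"
  assumes n: "n > 0" and sym: "\<And>i j. i < n \<Longrightarrow> j < n \<Longrightarrow> a i j = a j i"
  shows "\<exists>l x. (\<exists>i<n. x i \<noteq> 0) \<and> (\<forall>i<n. (\<Sum>j<n. a i j * x j) = l * x i)
    \<and> (\<forall>y. (\<Sum>i<n. \<Sum>j<n. a i j * y i * y j) \<le> l * (\<Sum>i<n. (y i)\<^sup>2))"
proof -
  define B where "B x y = (\<Sum>i<n. \<Sum>j<n. a i j * x i * y j)" for x y
  define N where "N y = (\<Sum>i<n. (y i)\<^sup>2)" for y :: "nat \<Rightarrow> real"
  define S where "S = {x :: nat \<Rightarrow> real. (\<forall>i\<ge>n. x i = 0) \<and> N x = 1}"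
  have "compact S"
    unfolding S_def N_def by (rule compact_unit_sphere_fun)
  \<comment> \<open>The first unit vector shows that the sphere is nonempty.\<close>
  moreover have "(\<lambda>i. if i = 0 then 1 else 0) \<in> S"
    using n by (simp add: S_def N_def if_distrib[of "\<lambda>z. z\<^sup>2"] cong: if_cong)
  moreover have "continuous_on S (\<lambda>x. B x x)"
    unfolding B_def
    by (intro continuous_intros continuous_on_subset[OF continuous_on_product_coordinates]) auto
  ultimately obtain x where x: "x \<in> S" and max: "\<And>y. y \<in> S \<Longrightarrow> B y y \<le> B x x"
    using continuous_attains_sup[of S "\<lambda>x. B x x"] by blast
  define l where "l = B x x"
  \<comment> \<open>Both sides are homogeneous of degree two, so the maximum on the sphere bounds
    the form everywhere.\<close>
  have bound: "B y y \<le> l * N y" for y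
  proof (cases "N y = 0")
    case True
    then have "\<forall>i<n. y i = 0"
      unfolding N_def by (subst (asm) sum_nonneg_eq_0_iff) auto
    then show ?thesis by (simp add: True B_def)
  next
    case False
    then have pos: "N y > 0" by (simp add: N_def order.not_eq_order_implies_strict sum_nonneg)
    define c where "c = sqrt (N y)"
    have c: "c\<^sup>2 = N y" "c \<noteq> 0" using pos by (auto simp: c_def)
    \<comment> \<open>The cut-off at \<open>n\<close> is needed because \<open>y\<close> is
      arbitrary there, whereas members of \<open>S\<close> vanish.\<close>
    define z where "z i = (if i < n then y i / c else 0)" for i
    have "N z = N y / c\<^sup>2"
      by (simp add: N_def z_def power_divide sum_divide_distrib)
    then have "z \<in> S" using c pos by (simp add: S_def z_def)
    moreover have "B z z = B y y / c\<^sup>2"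
      by (simp add: B_def z_def sum_divide_distrib power2_eq_square)
    ultimately show ?thesis using max[of z] pos by (simp add: c(1) l_def divide_le_eq)
  qed
  have eig: "(\<Sum>j<n. a i j * x j) = l * x i" if i: "i < n" for i
  proof -
    \<comment> \<open>The residual of the eigenvalue equation in coordinate \<open>i\<close>; it is
      tested by moving \<open>x\<close> by \<open>t\<close> along that coordinate.\<close>
    define r where "r = l * x i - (\<Sum>j<n. a i j * x j)"
    have N: "N (\<lambda>j. x j + t * of_bool (j = i)) = N x + 2 * t * x i + t\<^sup>2" for t
    proof -
      have "N (\<lambda>j. x j + t * of_bool (j = i))
          = (\<Sum>j<n. (x j)\<^sup>2 + (if j = i then 2 * t * x i + t\<^sup>2 else 0))"
        unfolding N_def by (intro sum.cong) (auto simp: power2_eq_square algebra_simps)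
      then show ?thesis using i by (simp add: sum.distrib N_def)
    qed
    have B: "B (\<lambda>j. x j + t * of_bool (j = i)) (\<lambda>j. x j + t * of_bool (j = i))
        = B x x + 2 * t * (\<Sum>j<n. a i j * x j) + t\<^sup>2 * a i i" for t
    proof -
      have "B (\<lambda>j. x j + t * of_bool (j = i)) (\<lambda>j. x j + t * of_bool (j = i))
          = (\<Sum>k<n. \<Sum>j<n. a k j * x k * x j + (if j = i then t * a k i * x k else 0)
             + (if k = i then t * a i j * x j + (if j = i then t\<^sup>2 * a i i else 0) else 0))"
        unfolding B_def by (intro sum.cong) (auto simp: power2_eq_square algebra_simps)
      also have "\<dots> = B x x + (\<Sum>k<n. t * a k i * x k) + ((\<Sum>j<n. t * a i j * x j) + t\<^sup>2 * a i i)"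
      proof -
        \<comment> \<open>The condition \<open>k = i\<close> does not involve \<open>j\<close>; once
          it is outside the inner sum, the outer sum collapses as well.\<close>
        have delta: "(\<Sum>j<n. if P then f j else 0) = (if P then \<Sum>j<n. f j else 0)"
          for P and f :: "nat \<Rightarrow> real" by simp
        show ?thesis using i by (simp add: sum.distrib B_def delta)
      qed
      also have "(\<Sum>k<n. t * a k i * x k) = t * (\<Sum>j<n. a i j * x j)"
        using i sym by (simp add: sum_distrib_left mult.assoc)
      also have "(\<Sum>j<n. t * a i j * x j) = t * (\<Sum>j<n. a i j * x j)"
        by (simp add: sum_distrib_left mult.assoc)
      finally show ?thesis by simp
    qed
    \<comment> \<open>The terms free of \<open>t\<close> cancel, since \<open>N x = 1\<close> and
      \<open>B x x = l\<close>. A quadratic in \<open>t\<close> without constant term that is never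
      negative has no linear term.\<close>
    have quad: "0 \<le> 2 * t * r + t\<^sup>2 * (l - a i i)" for t
      using bound[of "\<lambda>j. x j + t * of_bool (j = i)"] x
      unfolding N B by (simp add: S_def l_def r_def algebra_simps)
    have "r = 0"
    proof (rule ccontr)
      assume "r \<noteq> 0"
      \<comment> \<open>A positive bound on the quadratic coefficient; at \<open>t = - r / K\<close>
        the quadratic is then at most
        \<open>- 2 * r\<^sup>2 / K + r\<^sup>2 / K < 0\<close>.\<close>
      define K where "K = \<bar>l - a i i\<bar> + 1"
      have K: "K > 0" "l - a i i < K" by (auto simp: K_def)
      have "0 \<le> 2 * (- r / K) * r + (- r / K)\<^sup>2 * (l - a i i)" by (rule quad)
      also have "\<dots> \<le> 2 * (- r / K) * r + (- r / K)\<^sup>2 * K"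
        using K by (intro add_left_mono mult_left_mono) auto
      also have "\<dots> = - (r\<^sup>2 / K)"
        using K by (simp add: power2_eq_square field_simps)
      also have "\<dots> < 0" using \<open>r \<noteq> 0\<close> K by simp
      finally show False by simp
    qed
    then show ?thesis by (simp add: r_def)
  qed
  have "\<exists>i<n. x i \<noteq> 0"
  proof (rule ccontr)
    assume "\<not> ?thesis"
    then have "N x = 0" by (simp add: N_def)
    then show False using x by (simp add: S_def)
  qed
  then show ?thesis
    using eig bound unfolding B_def N_def by blast
qed

lemma entry_sum_le_Max_spectrum:
  fixes A :: "real mat"
  assumes A: "A \<in> carrier_mat n n" and n: "n > 0"
    and sym: "\<And>i j. i < n \<Longrightarrow> j < n \<Longrightarrow> A $$ (i, j) = A $$ (j, i)"
  shows "(\<Sum>i<n. \<Sum>j<n. A $$ (i, j)) \<le> Max (spectrum A) * n"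
proof -
  obtain l x where x: "\<exists>i<n. x i \<noteq> 0"
    and eig: "\<And>i. i < n \<Longrightarrow> (\<Sum>j<n. A $$ (i, j) * x j) = l * x i"
    and bound: "\<And>y. (\<Sum>i<n. \<Sum>j<n. A $$ (i, j) * y i * y j) \<le> l * (\<Sum>i<n. (y i)\<^sup>2)"
    using symmetric_form_eigenvector[of n "\<lambda>i j. A $$ (i, j)", OF n sym] by blast
  have "vec n x \<noteq> 0\<^sub>v n"
    using x by (metis index_vec index_zero_vec(1))
  moreover have "A *\<^sub>v vec n x = l \<cdot>\<^sub>v vec n x"
    using A by (intro eq_vecI) (auto simp: scalar_prod_def eig atLeast0LessThan)
  ultimately have "eigenvector A (vec n x) l"
    using A by (simp add: eigenvector_def)
  then have "l \<in> spectrum A"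
    by (auto simp: spectrum_def eigenvalue_def)
  then have "l \<le> Max (spectrum A)"
    using card_finite_spectrum[OF A] by simp
  moreover have "(\<Sum>i<n. \<Sum>j<n. A $$ (i, j)) \<le> l * n"
    using bound[of "\<lambda>_. 1"] by simp
  ultimately show ?thesis
    by (meson mult_right_mono of_nat_0_le_iff order_trans)
qed

section \<open>Hop distances\<close>

lemma graph_dist_le_walk:
  assumes "wf_digraph (with_proj G)" and "pre_digraph.awalk (with_proj G) u p v"
  shows "graph_dist G u v \<le> length p"
proof -
  interpret wf_digraph "with_proj G" by fact
  show ?thesis
    using min_cost_le_walk_cost[OF assms(2), of "\<lambda>_. 1"]
    by (simp add: graph_dist_def awalk_cost_def sum_list_triv)
qed

lemma graph_dist_ge:
  assumes "wf_digraph (with_proj G)"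
    and "\<And>p. pre_digraph.awalk (with_proj G) u p v \<Longrightarrow> k \<le> length p"
  shows "ereal k \<le> graph_dist G u v"
proof -
  interpret wf_digraph "with_proj G" by fact
  show ?thesis
    unfolding graph_dist_def \<mu>_def
    by (intro INF_greatest) (auto simp: awalk_cost_def sum_list_triv assms(2))
qed

text \<open>Reversing a walk preserves its length.\<close>

lemma graph_dist_commute:
  assumes "pair_sym_digraph G"
  shows "graph_dist G u v = graph_dist G v u"
proof -
  interpret pair_sym_digraph G by fact
  have "graph_dist G u v \<le> graph_dist G v u" for u v
    unfolding graph_dist_def[of G v u] \<mu>_def
  proof (rule INF_greatest)
    fix p assume "p \<in> {p. awalk v p u}"
    then have "awalk u (rev_path p) v" by simp
    then have "graph_dist G u v \<le> length (rev_path p)"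
      by (rule graph_dist_le_walk[OF wf_digraph_axioms])
    moreover have "length (rev_path p) = length p" by (induction p) auto
    ultimately show "graph_dist G u v \<le> ereal (awalk_cost (\<lambda>_. 1) p)"
      by (simp add: awalk_cost_def sum_list_triv)
  qed
  then show ?thesis by (simp add: order_antisym)
qed

section \<open>Line graphs\<close>

lemma wf_line_graph: "wf_digraph (with_proj (line_graph G))"
  by unfold_locales (auto simp: line_graph_def)

lemma sym_line_graph: "pair_sym_digraph (line_graph G)"
  by unfold_locales (auto simp: line_graph_def symmetric_def intro: symI)

text \<open>Consecutive edges of a walk in \<open>G\<close> share a vertex, so the walk lifts to the
  line graph. This keeps the distances there finite.\<close>

lemma line_graph_reachable:
  assumes "pair_graph G" and conn: "Digraph_Component.connected (with_proj G)"
    and "e \<in> edges G" and "f \<in> edges G"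
  shows "e \<rightarrow>\<^sup>*\<^bsub>with_proj (line_graph G)\<^esub> f"
proof -
  interpret pair_graph G by fact
  interpret L: wf_digraph "with_proj (line_graph G)" by (rule wf_line_graph)
  have sc: "strongly_connected (with_proj G)"
    using conn sym_arcs by (intro symmetric_connected_imp_strongly_connected)
  have meeting: "g \<rightarrow>\<^sup>*\<^bsub>with_proj (line_graph G)\<^esub> h"
    if "g \<in> edges G" "h \<in> edges G" "g \<inter> h \<noteq> {}" for g h
  proof (cases "g = h")
    case True
    then show ?thesis using that L.reachable_refl[of h] by (simp add: line_graph_def)
  next
    case False
    then have "(g, h) \<in> parcs (line_graph G)" using that by (simp add: line_graph_def)
    then show ?thesis by (intro L.reachable_adjI) simp
  qed
  obtain u u' where u: "e = {u, u'}" "(u, u') \<in> parcs G" using assms(3) by (auto simp: edges_def)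
  obtain v v' where v: "f = {v, v'}" "(v, v') \<in> parcs G" using assms(4) by (auto simp: edges_def)
  have "u \<rightarrow>\<^sup>*\<^bsub>with_proj G\<^esub> v"
    using sc in_arcsD1[OF u(2)] in_arcsD1[OF v(2)] by (simp add: strongly_connected_def)
  \<comment> \<open>The claim covers all edges at the current vertex: in a step from
    \<open>x\<close> to \<open>y\<close>, the edge \<open>{x, y}\<close> is already reached because
    it contains \<open>x\<close>, and it meets every edge at \<open>y\<close>.\<close>
  then have "\<forall>h\<in>edges G. v \<in> h \<longrightarrow> e \<rightarrow>\<^sup>*\<^bsub>with_proj (line_graph G)\<^esub> h"
  proof (induction rule: reachable_induct)
    case base
    then show ?case using meeting assms(3) u(1) by blast
  next
    case (step x y)
    then have xy: "{x, y} \<in> edges G" by (auto simp: edges_def)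
    show ?case
    proof (intro ballI impI)
      fix h assume "h \<in> edges G" "y \<in> h"
      then have "{x, y} \<rightarrow>\<^sup>*\<^bsub>with_proj (line_graph G)\<^esub> h"
        using xy by (intro meeting) auto
      then show "e \<rightarrow>\<^sup>*\<^bsub>with_proj (line_graph G)\<^esub> h"
        using step.IH xy L.reachable_trans by blast
    qed
  qed
  then show ?thesis using assms(4) v(1) by blast
qed

lemma card_edge:
  assumes "pair_graph G" and "e \<in> edges G"
  shows "card e = 2"
proof -
  interpret pair_graph G by fact
  show ?thesis using assms(2) no_loops by (force simp: edges_def)
qed

lemma finite_edges:
  assumes "pair_graph G"
  shows "finite (edges G)"
proof -
  interpret pair_graph G by fact
  have "edges G = (\<lambda>(u, v). {u, v}) ` parcs G" by (auto simp: edges_def)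
  then show ?thesis by (simp add: pair_finite_arcs)
qed

text \<open>A walk of length 0 forces \<open>e = f\<close>, and one of length 1 forces a common
  endpoint.\<close>

lemma line_graph_dist_ge:
  assumes G: "pair_graph G" "Digraph_Component.connected (with_proj G)"
    and e: "e \<in> edges G" and f: "f \<in> edges G"
  shows "2 - real (card (e \<inter> f)) \<le> real_of_ereal (graph_dist (line_graph G) e f)"
proof -
  interpret L: wf_digraph "with_proj (line_graph G)" by (rule wf_line_graph)
  obtain p where p: "L.awalk e p f"
    using line_graph_reachable[OF assms] by (auto simp: L.reachable_awalk)
  have fin: "finite e" "finite f"
    using card_edge[OF G(1)] e f by (auto intro!: card_ge_0_finite)
  \<comment> \<open>Subtraction on \<open>nat\<close> truncates, which can only raise the left side,
    so the real inequality still follows at the end.\<close>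
  have "2 - card (e \<inter> f) \<le> length q" if q: "L.awalk e q f" for q
  proof (cases "e = f")
    case True
    then show ?thesis using card_edge[OF G(1) e] by simp
  next
    case ne: False
    show ?thesis
    proof (cases q)
      case Nil
      then show ?thesis using q ne by (simp add: L.awalk_Nil_iff)
    next
      case (Cons a q')
      show ?thesis
      proof (cases q')
        case Nil
        then have "(e, f) \<in> parcs (line_graph G)"
          using q Cons by (cases a) (auto simp: L.awalk_Cons_iff L.awalk_Nil_iff)
        then have "card (e \<inter> f) > 0"
          using fin by (simp add: line_graph_def card_gt_0_iff)
        then show ?thesis using Cons by simp
      qed (use Cons in simp)
    qed
  qed
  then have "ereal (real (2 - card (e \<inter> f))) \<le> graph_dist (line_graph G) e f"
    by (rule graph_dist_ge[OF wf_line_graph])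
  \<comment> \<open>The walk \<open>p\<close> excludes the distance \<infinity>, which
    \<open>real_of_ereal\<close> would turn into 0.\<close>
  moreover have "graph_dist (line_graph G) e f \<le> ereal (real (length p))"
    using graph_dist_le_walk[OF wf_line_graph p] by simp
  ultimately have "real (2 - card (e \<inter> f)) \<le> real_of_ereal (graph_dist (line_graph G) e f)"
    by (cases "graph_dist (line_graph G) e f") auto
  then show ?thesis by linarith
qed

section \<open>Counting incidences between vertices and edges\<close>

text \<open>Sending an arc out of \<open>v\<close> to its underlying edge is injective, and by
  symmetry of the arcs it hits every edge at \<open>v\<close>.\<close>

lemma card_edges_at:
  assumes "pair_graph G"
  shows "card {e \<in> edges G. v \<in> e} = out_degree (with_proj G) v"
proof -
  interpret pair_graph G by fact
  have "{e \<in> edges G. v \<in> e} = (\<lambda>(u, w). {u, w}) ` out_arcs (with_proj G) v"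
    using arcs_symmetric by (fastforce simp: edges_def out_arcs_def image_iff insert_commute)
  moreover have "inj_on (\<lambda>(u, w). {u, w}) (out_arcs (with_proj G) v)"
    by (auto simp: inj_on_def out_arcs_def doubleton_eq_iff)
  ultimately show ?thesis
    by (simp add: card_image out_degree_def)
qed

lemma sum_card_edge_inter:
  assumes "pair_graph G"
  shows "(\<Sum>e\<in>edges G. \<Sum>f\<in>edges G. real (card (e \<inter> f)))
    = (\<Sum>v\<in>pverts G. (real (out_degree (with_proj G) v))\<^sup>2)"
proof -
  interpret pair_graph G by fact
  note fin = finite_edges[OF assms]
  have card: "real (card (e \<inter> f)) = (\<Sum>v\<in>pverts G. of_bool (v \<in> e) * of_bool (v \<in> f))"
    if "e \<in> edges G" for e f
  proof -
    have "e \<subseteq> pverts G" using that by (auto simp: edges_def dest: wellformed')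
    then have "pverts G \<inter> {v. v \<in> e \<and> v \<in> f} = e \<inter> f" by auto
    then show ?thesis
      using pair_finite_verts by (simp flip: of_bool_conj add: sum_of_bool_eq)
  qed
  have "(\<Sum>e\<in>edges G. \<Sum>f\<in>edges G. real (card (e \<inter> f)))
      = (\<Sum>e\<in>edges G. \<Sum>f\<in>edges G. \<Sum>v\<in>pverts G. of_bool (v \<in> e) * of_bool (v \<in> f))"
    by (simp add: card)
  also have "\<dots> = (\<Sum>e\<in>edges G. \<Sum>v\<in>pverts G. \<Sum>f\<in>edges G. of_bool (v \<in> e) * of_bool (v \<in> f))"
    by (intro sum.cong refl sum.swap)
  also have "\<dots> = (\<Sum>v\<in>pverts G. \<Sum>e\<in>edges G. \<Sum>f\<in>edges G. of_bool (v \<in> e) * of_bool (v \<in> f))"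
    by (rule sum.swap)
  \<comment> \<open>For fixed \<open>v\<close> the double sum of products factors into a
    square.\<close>
  also have "\<dots> = (\<Sum>v\<in>pverts G. (\<Sum>e\<in>edges G. of_bool (v \<in> e))\<^sup>2)"
    by (simp add: power2_eq_square sum_product)
  also have "\<dots> = (\<Sum>v\<in>pverts G. (real (out_degree (with_proj G) v))\<^sup>2)"
    using fin by (simp add: sum_of_bool_eq Int_def flip: card_edges_at[OF assms])
  finally show ?thesis .
qed

section \<open>Entry sum of the generalized distance matrix\<close>

lemma gen_distance_mat_sum:
  assumes "distinct vs" and "set vs = pverts G"
  shows "(\<Sum>i<length vs. \<Sum>j<length vs. gen_distance_mat \<alpha> G vs $$ (i, j))
    = (\<Sum>u\<in>pverts G. \<Sum>v\<in>pverts G. real_of_ereal (graph_dist G u v))"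
proof -
  have reindex: "(\<Sum>i<length vs. g (vs ! i)) = sum g (pverts G)" for g :: "'a \<Rightarrow> real"
    using sum.reindex_bij_betw[OF bij_betw_nth[OF assms(1) refl assms(2)[symmetric]]] by simp
  have "(\<Sum>j<length vs. gen_distance_mat \<alpha> G vs $$ (i, j)) = transmission G (vs ! i)"
    if i: "i < length vs" for i
  proof -
    have "(\<Sum>j<length vs. gen_distance_mat \<alpha> G vs $$ (i, j))
        = (\<Sum>j<length vs. (if j = i then \<alpha> * transmission G (vs ! i) else 0)
            + (1 - \<alpha>) * real_of_ereal (graph_dist G (vs ! i) (vs ! j)))"
      using i by (intro sum.cong)
        (auto simp: gen_distance_mat_def transmission_mat_def distance_mat_def)
    \<comment> \<open>The diagonal contributes once, and the distances in the row add up to the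
      transmission again, so \<alpha> cancels.\<close>
    also have "\<dots> = \<alpha> * transmission G (vs ! i) + (1 - \<alpha>) * transmission G (vs ! i)"
      using i by (simp add: sum.distrib transmission_def
        reindex[of "\<lambda>v. real_of_ereal (graph_dist G (vs ! i) v)"] flip: sum_distrib_left)
    finally show ?thesis by (simp add: algebra_simps)
  qed
  then have "(\<Sum>i<length vs. \<Sum>j<length vs. gen_distance_mat \<alpha> G vs $$ (i, j))
      = (\<Sum>i<length vs. transmission G (vs ! i))" by simp
  also have "\<dots> = (\<Sum>u\<in>pverts G. \<Sum>v\<in>pverts G. real_of_ereal (graph_dist G u v))"
    unfolding transmission_def by (rule reindex)
  finally show ?thesis .
qed

theorem theorem4p9:
  fixes G :: "'a pair_pre_digraph"
    and es :: "'a set list"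
    and \<alpha> :: real
  assumes "pair_graph G"
    and "Digraph_Component.connected (with_proj G)"
    and "edges G \<noteq> {}"
    and "0 \<le> \<alpha>" and "\<alpha> \<le> 1"
    and "diam G \<le> 2"
    and "\<not> has_induced_copy G F1"
    and "\<not> has_induced_copy G F2"
    and "\<not> has_induced_copy G F3"
    and "distinct es" and "set es = pverts (line_graph G)"
  shows "gen_distance_rho \<alpha> (line_graph G) es \<ge>
    (2 * (real (card (edges G)))\<^sup>2
      - (\<Sum>v\<in>pverts G. (real (out_degree (with_proj G) v))\<^sup>2)) / real (card (edges G))"
proof -
  define m where "m = card (edges G)"
  have verts: "pverts (line_graph G) = edges G" by (simp add: line_graph_def)
  have m: "length es = m" "m > 0"
    using assms(3,10,11) finite_edges[OF assms(1)] distinct_card[of es]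
    by (auto simp: verts m_def card_gt_0_iff)
  have "2 * (real m)\<^sup>2 - (\<Sum>v\<in>pverts G. (real (out_degree (with_proj G) v))\<^sup>2)
      = (\<Sum>e\<in>edges G. \<Sum>f\<in>edges G. 2 - real (card (e \<inter> f)))"
    \<comment> \<open>The term \<open>2 * (real m)\<^sup>2\<close> is the constant 2 summed over all
      ordered pairs of edges, equal ones included.\<close>
    unfolding sum_card_edge_inter[OF assms(1), symmetric]
    by (simp add: sum_subtractf m_def power2_eq_square)
  also have "\<dots> \<le> (\<Sum>e\<in>edges G. \<Sum>f\<in>edges G. real_of_ereal (graph_dist (line_graph G) e f))"
    by (intro sum_mono line_graph_dist_ge assms)
  also have "\<dots> = (\<Sum>i<m. \<Sum>j<m. gen_distance_mat \<alpha> (line_graph G) es $$ (i, j))"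
    using gen_distance_mat_sum[OF assms(10,11), of \<alpha>] by (simp add: m verts)
  also have "\<dots> \<le> Max (spectrum (gen_distance_mat \<alpha> (line_graph G) es)) * m"
  proof (rule entry_sum_le_Max_spectrum[OF _ m(2)])
    show "gen_distance_mat \<alpha> (line_graph G) es \<in> carrier_mat m m"
      by (simp add: gen_distance_mat_def transmission_mat_def distance_mat_def m)
  next
    fix i j assume "i < m" "j < m"
    moreover have "graph_dist (line_graph G) (es ! i) (es ! j)
        = graph_dist (line_graph G) (es ! j) (es ! i)"
      by (rule graph_dist_commute[OF sym_line_graph])
    ultimately show "gen_distance_mat \<alpha> (line_graph G) es $$ (i, j)
        = gen_distance_mat \<alpha> (line_graph G) es $$ (j, i)"
      by (simp add: gen_distance_mat_def transmission_mat_def distance_mat_def m)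
  qed
  finally show ?thesis
    using m(2) by (simp add: gen_distance_rho_def m_def divide_le_eq)
qed

end
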